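(* Let $n\ge1$, $1<p<\infty$, and let $\omega,\sigma$ be Radon measures on $\mathbb{R}^n$ such that $\sigma\in A_\infty$. If $\mathcal{A}_p(\omega,\sigma)<\infty$, then the pivotal condition holds, i.e. $\mathcal{V}(\omega,\sigma)<\infty$.
   Context: $|I|$ is the Lebesgue measure of the cube $I$, and $p'=p/(p-1)$. A measure $\sigma$ is in $A_\infty$ if $d\sigma=w(x)\,dx$ with $w$ a nonnegative, locally integrable, not a.e. zero function and there exist $C,\varepsilon>0$ such that $\frac{w(E)}{w(I)}\le C\left(\frac{|E|}{|I|}\right)^{\varepsilon}$ for all cubes $I\subset\mathbb{R}^n$ and measurable $E\subset I$, where $w(E)=\int_E w$. $\mathcal{A}_p(\omega,\sigma)=\sup_I\left(\frac{\omega(I)}{|I|}\right)^{1/p}\left(\frac{\sigma(I)}{|I|}\right)^{1/p'}$, supremum over all cubes $I\subset\mathbb{R}^n$. For a locally finite positive Borel measure $\mu$ and a cube $I$ define $$P(I,\mu)=\int_{\mathbb{R}^n}\left(\frac{|I|^{1/n}}{(|I|^{1/n}+\operatorname{dist}(x,I))^2}\right)^n\mu(dx).$$ Pivotal condition: $\mathcal{V}(\omega,\sigma)<\infty$, where $$\mathcal{V}(\omega,\sigma)^p=\sup_{I_0=\cup I_r}\frac{1}{\sigma(I_0)}\sum_{r\ge1}\omega(I_r)\,P(I_r,\mathbf{1}_{I_0}\sigma)^p,$$ the supremum being taken over all cubes $I_0$ with $\sigma(I_0)\ne0$ and all decompositions of $I_0$ into disjoint cubes $\{I_r\}_{r\in\mathbb{N}}$.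 *)

theory Defs
  imports "HOL-Analysis.Analysis"
begin

text \<open>
  Cubes are axis-parallel and half-open, so that a cube can be decomposed into pairwise disjoint
  cubes without exceptional boundary sets. A type of class \<^class>\<open>euclidean_space\<close> plays the
  role of \<open>\<real>\<^sup>n\<close>, with \<open>n = DIM('a) \<ge> 1\<close>.
\<close>

definition cubes :: "'a::euclidean_space set set" where
  "cubes = {{x. \<forall>b\<in>Basis. a \<bullet> b \<le> x \<bullet> b \<and> x \<bullet> b < a \<bullet> b + l} | a l. 0 < l}"

text \<open>Powers of extended nonnegative reals; only meant for exponents \<open>a > 0\<close>.\<close>

definition ennpowr :: "ennreal \<Rightarrow> real \<Rightarrow> ennreal" where
  "ennpowr x a = (if x = \<infinity> then \<infinity> else ennreal (enn2real x powr a))"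

definition radon_measure :: "'a::euclidean_space measure \<Rightarrow> bool" where
  "radon_measure \<mu> \<longleftrightarrow> sets \<mu> = sets borel \<and> (\<forall>K. compact K \<longrightarrow> emeasure \<mu> K < \<infinity>)"

text \<open>
  Definitions of Radon measures often demand inner regularity as well. In Euclidean space this
  is automatic.
\<close>

lemma radon_measure_inner_regular:
  fixes \<mu> :: "'a::euclidean_space measure"
  assumes "radon_measure \<mu>" and B: "B \<in> sets borel"
  shows "emeasure \<mu> B = (SUP K\<in>{K. K \<subseteq> B \<and> compact K}. emeasure \<mu> K)" (is "_ = ?S")
proof (rule antisym)
  have sets_mu: "sets \<mu> = sets borel" and fin: "\<And>K. compact K \<Longrightarrow> emeasure \<mu> K < \<infinity>"
    using assms(1) by (auto simp: radon_measure_def)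
  have bound: "emeasure \<mu> (B \<inter> cball 0 (real n)) \<le> ?S" for n
  proof -
    let ?C = "cball (0::'a) (real n)"
    let ?N = "density \<mu> (indicator ?C)"
    have C: "?C \<in> sets \<mu>" by (simp add: sets_mu)
    have em: "emeasure ?N A = emeasure \<mu> (A \<inter> ?C)" if A: "A \<in> sets borel" for A
    proof -
      have "emeasure ?N A = (\<integral>\<^sup>+ x. indicator ?C x * indicator A x \<partial>\<mu>)"
        using A C by (subst emeasure_density) (simp_all add: sets_mu borel_measurable_indicator)
      also have "\<dots> = (\<integral>\<^sup>+ x. indicator (A \<inter> ?C) x \<partial>\<mu>)"
        by (intro nn_integral_cong) (simp split: split_indicator)
      also have "\<dots> = emeasure \<mu> (A \<inter> ?C)"
        using A C by (intro nn_integral_indicator) (auto simp: sets_mu)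
      finally show ?thesis .
    qed
    have "emeasure ?N (space ?N) \<noteq> \<infinity>"
      using em[of UNIV] fin[of ?C] sets_eq_imp_space_eq[OF sets_mu] by simp
    then have "emeasure ?N B = (SUP K\<in>{K. K \<subseteq> B \<and> compact K}. emeasure ?N K)"
      using B by (intro inner_regular) (simp_all add: sets_mu)
    also have "\<dots> \<le> ?S"
    proof (rule SUP_least)
      fix K assume K: "K \<in> {K. K \<subseteq> B \<and> compact K}"
      then have "emeasure ?N K = emeasure \<mu> (K \<inter> ?C)"
        by (intro em) (simp add: borel_compact)
      also have "\<dots> \<le> ?S"
        using K by (intro SUP_upper) (auto simp: compact_Int_closed)
      finally show "emeasure ?N K \<le> ?S" .
    qed
    finally show ?thesis by (simp add: em B)
  qed
  have "(\<Union>n. B \<inter> cball 0 (real n)) = B"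
    by (auto simp: real_arch_simple)
  moreover have "(SUP n. emeasure \<mu> (B \<inter> cball 0 (real n)))
      = emeasure \<mu> (\<Union>n. B \<inter> cball 0 (real n))"
    by (intro SUP_emeasure_incseq) (auto simp: incseq_def sets_mu B)
  ultimately have "emeasure \<mu> B = (SUP n. emeasure \<mu> (B \<inter> cball 0 (real n)))" by simp
  also have "\<dots> \<le> ?S" by (intro SUP_least bound)
  finally show "emeasure \<mu> B \<le> ?S" .
  show "?S \<le> emeasure \<mu> B"
    by (intro SUP_least emeasure_mono) (auto simp: sets_mu B)
qed

text \<open>
  Measures are Borel measures, so the weight \<open>w\<close> and the sets \<open>E\<close> are taken Borel measurable;
  every Lebesgue measurable function or set agrees with a Borel one up to a null set. If
  \<open>w(I) = 0\<close>, the quotient \<open>w(E) / w(I)\<close> is \<open>0 / 0 = 0\<close>; the condition nevertheless forces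
  \<open>w(I) > 0\<close> for every cube, since otherwise one could enlarge \<open>I\<close> slightly beyond a maximal null
  cube.
\<close>

definition A_infty :: "'a::euclidean_space measure \<Rightarrow> bool" where
  "A_infty \<sigma> \<longleftrightarrow>
    (\<exists>w \<in> borel_measurable lborel.
      (\<forall>x. 0 \<le> w x) \<and>
      (\<forall>K. compact K \<longrightarrow> set_integrable lborel K w) \<and>
      \<not> (AE x in lborel. w x = (0::real)) \<and>
      \<sigma> = density lborel (\<lambda>x. ennreal (w x)) \<and>
      (\<exists>C \<epsilon>. 0 < C \<and> 0 < \<epsilon> \<and>
        (\<forall>I\<in>cubes. \<forall>E\<in>sets lborel. E \<subseteq> I \<longrightarrow>
          (LINT x:E|lborel. w x) / (LINT x:I|lborel. w x)
            \<le> C * (measure lborel E / measure lborel I) powr \<epsilon>)))"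

definition conj_exponent :: "real \<Rightarrow> real" where
  "conj_exponent p = p / (p - 1)"

definition A_const :: "real \<Rightarrow> 'a::euclidean_space measure \<Rightarrow> 'a measure \<Rightarrow> ennreal" where
  "A_const p \<omega> \<sigma> =
    (SUP I\<in>cubes. ennpowr (emeasure \<omega> I / emeasure lborel I) (1 / p) *
                  ennpowr (emeasure \<sigma> I / emeasure lborel I) (1 / conj_exponent p))"

definition side_length :: "'a::euclidean_space set \<Rightarrow> real" where
  "side_length I = measure lborel I powr (1 / real DIM('a))"

definition P_int :: "'a::euclidean_space set \<Rightarrow> 'a measure \<Rightarrow> ennreal" where
  "P_int I \<mu> =
    (\<integral>\<^sup>+ x. ennreal ((side_length I / (side_length I + infdist x I)\<^sup>2) ^ DIM('a)) \<partial>\<mu>)"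

text \<open>
  Decompositions are countable, i.e. finite or countably infinite; they are represented by the
  set of their members.
\<close>

definition cube_decompositions :: "('a::euclidean_space set \<times> 'a set set) set" where
  "cube_decompositions =
    {(I\<^sub>0, \<I>). I\<^sub>0 \<in> cubes \<and> \<I> \<subseteq> cubes \<and> countable \<I> \<and> partition_on I\<^sub>0 \<I>}"

definition pivotal_const :: "real \<Rightarrow> 'a::euclidean_space measure \<Rightarrow> 'a measure \<Rightarrow> ennreal" where
  "pivotal_const p \<omega> \<sigma> =
    ennpowr
      (SUP (I\<^sub>0, \<I>) \<in> {(I\<^sub>0, \<I>) \<in> cube_decompositions. emeasure \<sigma> I\<^sub>0 \<noteq> 0}.
        (\<Sum>\<^sub>\<infinity>I\<in>\<I>. emeasure \<omega> I * ennpowr (P_int I (density \<sigma> (indicator I\<^sub>0))) p)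
          / emeasure \<sigma> I\<^sub>0)
      (1 / p)"

definition pivotal_condition :: "real \<Rightarrow> 'a::euclidean_space measure \<Rightarrow> 'a measure \<Rightarrow> bool" where
  "pivotal_condition p \<omega> \<sigma> \<longleftrightarrow> pivotal_const p \<omega> \<sigma> < \<infinity>"

end

theory Submission
  imports Defs
begin

text \<open>
  Write \<open>n\<close> for the dimension and \<open>\<sigma>\<^sub>Q = \<sigma>(Q) / |Q|\<close>. For a decomposition of \<open>I\<^sub>0\<close> into cubes \<open>I\<close>, the
  kernel of \<open>P(I, \<cdot>)\<close> decays like a geometric series over dyadic annuli around \<open>I\<close>, so
  \<open>P(I, 1\<^sub>I\<^sub>0 \<sigma>)\<close> is bounded by a constant times the average \<open>v\<^sub>I\<close> of \<open>\<sigma>\<close> over some cube concentric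
  with \<open>I\<close>, containing \<open>I\<close>, of side at most \<open>4\<close> times that of \<open>I\<^sub>0\<close> (\<open>P_int_le_average\<close>). It remains
  to bound \<open>\<Sum>\<^sub>I \<omega>(I) v\<^sub>I\<^sup>p\<close> by a constant times \<open>\<sigma>(I\<^sub>0)\<close>; this is Sawyer's testing condition for the maximal function
  in discrete form.

  Fix a level \<open>T\<close> and consider the cubes \<open>I\<close> with \<open>v\<^sub>I \<ge> T\<close>. A Vitali selection from the concentric
  cubes that realise the averages gives disjoint sets with union \<open>E\<close> whose fixed dilates cover all
  these \<open>I\<close>. Since \<open>A\<^sub>p\<close> gives \<open>\<sigma>\<^sub>Q\<^sup>p \<omega>(Q) \<le> K \<sigma>(Q)\<close>, and since \<open>\<sigma>\<close> is doubling (\<open>A_infty_doubling\<close>),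
  the total \<open>\<omega>\<close>-mass of these \<open>I\<close> times \<open>T\<^sup>p\<close> is bounded by a constant times \<open>\<sigma>(E)\<close>. On the other hand
  each selected cube has volume at most its \<open>\<sigma>\<close>-mass over \<open>T\<close>, so \<open>|E|\<close> is at most a constant times
  \<open>\<sigma>(I\<^sub>0) / T\<close>, and \<open>A\<^sub>\<infinity>\<close> converts this into \<open>\<sigma>(E) \<le> M (\<sigma>\<^sub>I\<^sub>0 / T)\<^sup>\<epsilon> \<sigma>(I\<^sub>0)\<close> (\<open>level_family_bound\<close>).

  All \<open>v\<^sub>I\<close> are at least \<open>4\<^sup>-\<^sup>n \<sigma>\<^sub>I\<^sub>0\<close>, so only the levels \<open>T = 2\<^sup>i 4\<^sup>-\<^sup>n \<sigma>\<^sub>I\<^sub>0\<close> with \<open>i \<ge> 0\<close> matter, and the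
  bounds for them sum to a convergent geometric series (\<open>sum_powr_le_of_level_decay\<close>).
\<close>

section \<open>Centred cubes\<close>

text \<open>
  Every quantitative step below dilates a cube about its centre, so cubes are described by centre
  and half side length; \<open>cell c h\<close> is the half-open ball of radius \<open>h\<close> in the maximum norm.
\<close>

definition cell :: "'a::euclidean_space \<Rightarrow> real \<Rightarrow> 'a set" where
  "cell c h = {x. \<forall>b\<in>Basis. c \<bullet> b - h \<le> x \<bullet> b \<and> x \<bullet> b < c \<bullet> b + h}"

lemma cell_in_cubes:
  assumes "0 < h"
  shows "cell c h \<in> cubes"
proof -
  let ?a = "c - h *\<^sub>R One"
  have "cell c h = {x. \<forall>b\<in>Basis. ?a \<bullet> b \<le> x \<bullet> b \<and> x \<bullet> b < ?a \<bullet> b + 2 * h}"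
    by (auto simp: cell_def inner_diff_left)
  then show ?thesis
    using assms unfolding cubes_def by (auto intro!: exI[of _ ?a] exI[of _ "2 * h"])
qed

lemma cubes_cellE:
  fixes I :: "'a::euclidean_space set"
  assumes "I \<in> cubes"
  obtains c h where "0 < h" "I = cell c h"
proof -
  from assms obtain a :: 'a and l :: real
    where l: "0 < l" and I: "I = {x. \<forall>b\<in>Basis. a \<bullet> b \<le> x \<bullet> b \<and> x \<bullet> b < a \<bullet> b + l}"
    unfolding cubes_def by blast
  have "I = cell (a + (l / 2) *\<^sub>R One) (l / 2)"
    by (auto simp: I cell_def inner_add_left)
  with l show thesis by (intro that[of "l / 2"]) auto
qed

lemma cell_borel [measurable, simp]: "cell c h \<in> sets borel"
proof -
  have "cell c h = (\<Inter>b\<in>Basis. {x. c \<bullet> b - h \<le> x \<bullet> b} \<inter> {x. x \<bullet> b < c \<bullet> b + h})"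
    by (auto simp: cell_def)
  also have "\<dots> \<in> sets borel"
    by (intro sets.countable_INT'' sets.finite_INT) auto
  finally show ?thesis .
qed

lemma box_subset_cell: "box (c - h *\<^sub>R One) (c + h *\<^sub>R One) \<subseteq> cell c h"
  by (auto simp: cell_def box_def inner_diff_left inner_add_left less_imp_le)

lemma cell_subset_cbox: "cell c h \<subseteq> cbox (c - h *\<^sub>R One) (c + h *\<^sub>R One)"
  by (auto simp: cell_def cbox_def inner_diff_left inner_add_left less_imp_le)

text \<open>
  The half-open cube lies between the open and the closed box, which have the same volume.
\<close>

lemma emeasure_lborel_cell:
  fixes c :: "'a::euclidean_space"
  assumes "0 < h"
  shows "emeasure lborel (cell c h) = ennreal ((2 * h) ^ DIM('a))"
proof (rule antisym)
  have prod: "(\<Prod>b\<in>Basis. ((c + h *\<^sub>R One) - (c - h *\<^sub>R One)) \<bullet> b) = (2 * h) ^ DIM('a)"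
    by (simp add: inner_diff_left inner_add_left)
  have "emeasure lborel (cell c h) \<le> emeasure lborel (cbox (c - h *\<^sub>R One) (c + h *\<^sub>R One))"
    by (intro emeasure_mono cell_subset_cbox) simp
  also have "\<dots> = ennreal ((2 * h) ^ DIM('a))"
    using assms by (subst emeasure_lborel_cbox) (auto simp: prod[symmetric] inner_diff_left inner_add_left)
  finally show "emeasure lborel (cell c h) \<le> ennreal ((2 * h) ^ DIM('a))" .
  have "ennreal ((2 * h) ^ DIM('a)) = emeasure lborel (box (c - h *\<^sub>R One) (c + h *\<^sub>R One))"
    using assms by (subst emeasure_lborel_box) (auto simp: prod[symmetric] inner_diff_left inner_add_left)
  also have "\<dots> \<le> emeasure lborel (cell c h)"
    by (intro emeasure_mono box_subset_cell) simp
  finally show "ennreal ((2 * h) ^ DIM('a)) \<le> emeasure lborel (cell c h)" .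
qed

lemma measure_lborel_cell:
  fixes c :: "'a::euclidean_space"
  assumes "0 < h"
  shows "measure lborel (cell c h) = (2 * h) ^ DIM('a)"
  using assms by (simp add: measure_def emeasure_lborel_cell)

lemma side_length_cell:
  fixes c :: "'a::euclidean_space"
  assumes "0 < h"
  shows "side_length (cell c h) = 2 * h"
proof -
  have "measure lborel (cell c h) = (2 * h) powr real DIM('a)"
    unfolding measure_lborel_cell[OF assms] using assms by (intro powr_realpow[symmetric]) simp
  then show ?thesis
    using assms by (simp add: side_length_def powr_powr)
qed

lemma cell_mono: "h \<le> h' \<Longrightarrow> cell c h \<subseteq> cell c h'"
  by (fastforce simp: cell_def)

lemma center_in_cell: "0 < h \<Longrightarrow> c \<in> cell c h"
  by (auto simp: cell_def)

lemma cell_subset_shifted_cell: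
  assumes "c \<in> cell c' h'"
  shows "cell c h \<subseteq> cell c' (h' + h)"
  using assms by (fastforce simp: cell_def)

lemma cell_subset_recentered_cell:
  assumes "c \<in> cell c' h'"
  shows "cell c' h' \<subseteq> cell c (2 * h')"
  using assms by (fastforce simp: cell_def)

lemma ball_subset_cell: "ball c r \<subseteq> cell c r"
proof
  fix x assume x: "x \<in> ball c r"
  have "\<bar>(x - c) \<bullet> b\<bar> < r" if "b \<in> Basis" for b
    using Basis_le_norm[OF that, of "x - c"] x by (simp add: dist_norm norm_minus_commute)
  then show "x \<in> cell c r"
    by (fastforce simp: cell_def inner_diff_left abs_less_iff)
qed

lemma cell_subset_ball:
  fixes c :: "'a::euclidean_space"
  assumes "0 < h"
  shows "cell c h \<subseteq> ball c (2 * real DIM('a) * h)"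
proof
  fix x assume x: "x \<in> cell c h"
  have "norm (x - c) \<le> (\<Sum>b\<in>Basis. \<bar>(x - c) \<bullet> b\<bar>)"
    by (rule norm_le_l1)
  also have "\<dots> \<le> (\<Sum>b\<in>(Basis::'a set). h)"
    using x by (intro sum_mono) (fastforce simp: cell_def inner_diff_left abs_le_iff)
  also have "\<dots> < 2 * real DIM('a) * h"
    using assms by simp
  finally show "x \<in> ball c (2 * real DIM('a) * h)"
    by (simp add: dist_norm norm_minus_commute)
qed

text \<open>
  \<open>infdist\<close> is Euclidean while cubes are balls of the maximum norm; a single coordinate in which \<open>y\<close>
  leaves the larger cube already gives the lower bound, because each coordinate difference is
  at most the Euclidean distance.
\<close>

lemma infdist_cell_ge:
  assumes "0 < s" "y \<notin> cell c h"
  shows "h - s \<le> infdist y (cell c s)"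
proof -
  from assms(2) obtain b where b: "b \<in> Basis" and yb: "h \<le> \<bar>(y - c) \<bullet> b\<bar>"
    by (force simp: cell_def inner_diff_left)
  have "h - s \<le> dist y x" if "x \<in> cell c s" for x
  proof -
    have "\<bar>(x - c) \<bullet> b\<bar> \<le> s"
      using that b by (fastforce simp: cell_def inner_diff_left abs_le_iff)
    then have "h - s \<le> \<bar>(y - x) \<bullet> b\<bar>"
      using yb by (simp add: inner_diff_left)
    also have "\<dots> \<le> dist y x"
      using Basis_le_norm[OF b, of "y - x"] by (simp add: dist_norm)
    finally show ?thesis .
  qed
  moreover have "cell c s \<noteq> {}"
    using center_in_cell[OF assms(1)] by blast
  ultimately show ?thesis
    by (simp add: infdist_notempty cINF_greatest)
qed

lemma cell_half_side_le:
  fixes c c' :: "'a::euclidean_space"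
  assumes "0 < h" "0 < h'" "cell c h \<subseteq> cell c' h'"
  shows "h \<le> h'"
proof -
  have "emeasure lborel (cell c h) \<le> emeasure lborel (cell c' h')"
    using assms(3) by (rule emeasure_mono) simp
  then have "(2 * h) ^ DIM('a) \<le> (2 * h') ^ DIM('a)"
    using assms(1,2) by (simp add: emeasure_lborel_cell)
  then show ?thesis
    using assms(1,2) power_mono_iff[of "2 * h" "2 * h'" "DIM('a)"] by simp
qed

section \<open>Radon measures on bounded sets\<close>

lemma sets_radon: "radon_measure \<mu> \<Longrightarrow> sets \<mu> = sets borel"
  by (simp add: radon_measure_def)

lemma radon_bounded_finite:
  assumes "radon_measure \<mu>" "bounded A"
  shows "emeasure \<mu> A < \<infinity>"
proof -
  have "emeasure \<mu> A \<le> emeasure \<mu> (closure A)"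
    using assms(1) by (intro emeasure_mono closure_subset) (simp add: sets_radon)
  also have "\<dots> < \<infinity>"
    using assms by (simp add: radon_measure_def compact_closure)
  finally show ?thesis .
qed

lemma bounded_cell: "bounded (cell c h)"
  by (rule bounded_subset[OF bounded_cbox cell_subset_cbox])

lemma radon_fmeasurable:
  assumes "radon_measure \<mu>" "A \<in> sets borel" "bounded A"
  shows "A \<in> fmeasurable \<mu>"
  using assms radon_bounded_finite[of \<mu> A] by (simp add: fmeasurable_def sets_radon)

lemma radon_fmeasurable_cell: "radon_measure \<mu> \<Longrightarrow> cell c h \<in> fmeasurable \<mu>"
  by (simp add: radon_fmeasurable bounded_cell)

lemma radon_measure_mono:
  assumes "radon_measure \<mu>" "A \<in> sets borel" "B \<in> sets borel" "bounded B" "A \<subseteq> B"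
  shows "measure \<mu> A \<le> measure \<mu> B"
  using assms by (intro measure_mono_fmeasurable radon_fmeasurable) (auto simp: sets_radon)

lemma emeasure_radon_eq:
  assumes "radon_measure \<mu>" "bounded A"
  shows "emeasure \<mu> A = ennreal (measure \<mu> A)"
  using radon_bounded_finite[OF assms] by (intro emeasure_eq_ennreal_measure) auto

section \<open>Quantitative consequences of the hypotheses\<close>

text \<open>
  The \<open>A\<^sub>\<infinity>\<close> inequality in multiplied-out form. Unlike the quotient form it says something even when
  the cube has measure \<open>0\<close>: its subsets are then null as well.
\<close>

lemma A_infty_measure_bound:
  fixes \<sigma> :: "'a::euclidean_space measure"
  assumes "radon_measure \<sigma>" "A_infty \<sigma>"
  obtains C \<epsilon> where "0 < C" "0 < \<epsilon>"
    "\<And>c h E. 0 < h \<Longrightarrow> E \<in> sets borel \<Longrightarrow> E \<subseteq> cell c h \<Longrightarrow>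
      measure \<sigma> E \<le> C * (measure lborel E / measure lborel (cell c h)) powr \<epsilon> * measure \<sigma> (cell c h)"
proof -
  from assms(2) obtain w C \<epsilon> where w: "w \<in> borel_measurable lborel" "\<forall>x. 0 \<le> w x"
    and int: "\<forall>K. compact K \<longrightarrow> set_integrable lborel K w"
    and \<sigma>: "\<sigma> = density lborel (\<lambda>x. ennreal (w x))" and C: "0 < C" "0 < \<epsilon>"
    and le: "\<forall>I\<in>cubes. \<forall>E\<in>sets lborel. E \<subseteq> I \<longrightarrow>
        (LINT x:E|lborel. w x) / (LINT x:I|lborel. w x)
            \<le> C * (measure lborel E / measure lborel I) powr \<epsilon>"
    unfolding A_infty_def by (elim bexE conjE exE) (rule that; assumption)
  have eq: "(LINT x:E|lborel. w x) = measure \<sigma> E" if "E \<in> sets borel" "bounded E" for E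
  proof -
    have E: "E \<in> sets lborel" using that by simp
    have "set_integrable lborel (closure E) w"
      using int that(2) by (simp add: compact_closure)
    then have sint: "set_integrable lborel E w"
      by (rule set_integrable_subset) (use that closure_subset in auto)
    have "emeasure \<sigma> E = (\<integral>\<^sup>+ x. ennreal (w x) * indicator E x \<partial>lborel)"
      unfolding \<sigma> using w E by (intro emeasure_density) auto
    also have "\<dots> = (\<integral>\<^sup>+ x. ennreal (indicator E x *\<^sub>R w x) \<partial>lborel)"
      by (intro nn_integral_cong) (auto split: split_indicator)
    also have "\<dots> = ennreal (LINT x:E|lborel. w x)"
      unfolding set_lebesgue_integral_def
      using sint w(2) by (intro nn_integral_eq_integral) (auto simp: set_integrable_def)
    finally have "emeasure \<sigma> E = ennreal (LINT x:E|lborel. w x)" .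
    moreover have "0 \<le> (LINT x:E|lborel. w x)"
      unfolding set_lebesgue_integral_def using w(2) by (intro integral_nonneg_AE) auto
    ultimately show ?thesis by (simp add: measure_def)
  qed
  show thesis
  proof (rule that[OF C])
    fix c :: 'a and h :: real and E assume h: "0 < h" and E: "E \<in> sets borel" "E \<subseteq> cell c h"
    have bd: "bounded E" using E(2) bounded_cell bounded_subset by blast
    let ?r = "C * (measure lborel E / measure lborel (cell c h)) powr \<epsilon>"
    have le': "measure \<sigma> E / measure \<sigma> (cell c h) \<le> ?r"
      using le[rule_format, OF cell_in_cubes[OF h], of E c] E by (simp add: eq bd bounded_cell)
    show "measure \<sigma> E \<le> ?r * measure \<sigma> (cell c h)"
    proof (cases "measure \<sigma> (cell c h) = 0")
      case True
      then show ?thesis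
        using radon_measure_mono[OF assms(1) E(1) _ bounded_cell E(2)] by simp
    next
      case False
      then have "0 < measure \<sigma> (cell c h)" by (simp add: zero_less_measure_iff)
      with le' show ?thesis by (simp add: pos_divide_le_eq)
    qed
  qed
qed

text \<open>
  A shell around a cube that is thin enough occupies so small a fraction of the enlarged cube that,
  by \<open>A\<^sub>\<infinity>\<close>, it carries at most half of the mass of the enlarged cube. Hence dilation by a factor
  \<open>q > 1\<close> slightly above \<open>1\<close> at most doubles the mass, and iteration reaches any dilation
  factor.
\<close>

lemma A_infty_doubling:
  fixes \<sigma> :: "'a::euclidean_space measure"
  assumes radon: "radon_measure \<sigma>" and C: "0 < C" "0 < \<epsilon>"
    and A_inf: "\<And>c h E. 0 < h \<Longrightarrow> E \<in> sets borel \<Longrightarrow> E \<subseteq> cell c h \<Longrightarrow>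
      measure \<sigma> E \<le> C * (measure lborel E / measure lborel (cell c h)) powr \<epsilon> * measure \<sigma> (cell c h)"
  shows "\<exists>D>0. \<forall>c h. 0 < h \<longrightarrow> measure \<sigma> (cell c (t * h)) \<le> D * measure \<sigma> (cell c h)"
proof -
  define n where "n = DIM('a)"
  have n: "0 < n" by (simp add: n_def)
  \<comment> \<open>\<open>\<eta>\<close> is the volume fraction at which the \<open>A\<^sub>\<infinity>\<close> bound is exactly one half\<close>
  define \<eta> where "\<eta> = (1 / (2 * C)) powr (1 / \<epsilon>)"
  have \<eta>: "0 < \<eta>" "C * \<eta> powr \<epsilon> = 1 / 2"
    using C by (simp_all add: \<eta>_def powr_powr)
  define q where "q = 1 + \<eta> / n"
  have q: "1 < q" using \<eta> n by (simp add: q_def)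
  have step: "measure \<sigma> (cell c (q * h)) \<le> 2 * measure \<sigma> (cell c h)" if h: "0 < h" for c h
  proof -
    have qh: "0 < q * h" "h \<le> q * h" using h q by auto
    let ?E = "cell c (q * h) - cell c h"
    have sub: "cell c h \<subseteq> cell c (q * h)" using qh by (intro cell_mono)
    have diff: "measure \<sigma> ?E = measure \<sigma> (cell c (q * h)) - measure \<sigma> (cell c h)"
      using radon sub by (intro measurable_measure_Diff radon_fmeasurable_cell) (simp_all add: sets_radon)
    have "measure lborel ?E = measure lborel (cell c (q * h)) - measure lborel (cell c h)"
      using sub qh by (intro measurable_measure_Diff) (auto simp: fmeasurable_def emeasure_lborel_cell)
    also have "\<dots> = (2 * (q * h)) ^ n - (2 * h) ^ n"
      using h qh by (simp add: measure_lborel_cell n_def)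
    finally have "measure lborel ?E / measure lborel (cell c (q * h)) = 1 - (1 / q) ^ n"
      using h q by (simp add: measure_lborel_cell n_def[symmetric] power_mult_distrib power_divide field_simps)
    also have "\<dots> \<le> \<eta>"
    proof -
      have "1 - (1 / q) = (q - 1) / q" using q by (simp add: field_simps)
      also have "\<dots> \<le> (q - 1) / 1" using q by (intro divide_left_mono) auto
      finally have a: "1 - \<eta> / n \<le> 1 / q" by (simp add: q_def)
      have "1 - \<eta> = 1 + real n * ((1 / q - 1) + (1 - \<eta> / n - 1 / q))"
        using n by (simp add: field_simps)
      also have "\<dots> \<le> 1 + real n * (1 / q - 1)"
        using a by (intro add_left_mono mult_left_mono) auto
      also have "\<dots> \<le> (1 + (1 / q - 1)) ^ n"
        using q by (intro Bernoulli_inequality) (simp add: field_simps)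
      finally show ?thesis by simp
    qed
    finally have ratio: "measure lborel ?E / measure lborel (cell c (q * h)) \<le> \<eta>" .
    have "measure \<sigma> ?E
        \<le> C * (measure lborel ?E / measure lborel (cell c (q * h))) powr \<epsilon> * measure \<sigma> (cell c (q * h))"
      using qh by (intro A_inf) auto
    also have "\<dots> \<le> C * \<eta> powr \<epsilon> * measure \<sigma> (cell c (q * h))"
      using C ratio by (intro mult_right_mono mult_left_mono powr_mono2) auto
    finally show ?thesis using diff \<eta>(2) by simp
  qed
  have iter: "measure \<sigma> (cell c (q ^ m * h)) \<le> 2 ^ m * measure \<sigma> (cell c h)" if h: "0 < h" for c h m
  proof (induction m)
    case (Suc m)
    have "measure \<sigma> (cell c (q ^ Suc m * h)) \<le> 2 * measure \<sigma> (cell c (q ^ m * h))"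
      using step[of "q ^ m * h" c] h q by (simp add: mult.assoc)
    with Suc show ?case by simp
  qed simp
  obtain m where m: "t < q ^ m" using real_arch_pow[OF q] by blast
  have "measure \<sigma> (cell c (t * h)) \<le> 2 ^ m * measure \<sigma> (cell c h)" if h: "0 < h" for c h
  proof -
    have "measure \<sigma> (cell c (t * h)) \<le> measure \<sigma> (cell c (q ^ m * h))"
      using m h by (intro radon_measure_mono[OF radon] cell_mono bounded_cell) auto
    with iter[OF h, of c m] show ?thesis by simp
  qed
  then show ?thesis by (intro exI[of _ "2 ^ m"]) auto
qed

text \<open>
  The \<open>A\<^sub>p\<close> condition says \<open>\<omega>(Q) \<sigma>(Q)\<^sup>p\<^sup>-\<^sup>1 \<le> K |Q|\<^sup>p\<close>. Multiplied by \<open>\<sigma>(Q)\<close> it trades \<open>\<omega>\<close>-mass, weighted by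
  the \<open>p\<close>-th power of the \<open>\<sigma>\<close>-average, for \<open>\<sigma>\<close>-mass. This is the only way \<open>\<omega>\<close> is controlled.
\<close>

lemma A_const_measure_bound:
  fixes \<omega> \<sigma> :: "'a::euclidean_space measure"
  assumes p: "1 < p" and radon: "radon_measure \<omega>" "radon_measure \<sigma>" and A: "A_const p \<omega> \<sigma> < \<infinity>"
  obtains K where "0 \<le> K"
    "\<And>c h. 0 < h \<Longrightarrow> (measure \<sigma> (cell c h) / measure lborel (cell c h)) powr p * measure \<omega> (cell c h)
       \<le> K * measure \<sigma> (cell c h)"
proof -
  from A obtain A where A: "A_const p \<omega> \<sigma> = ennreal A" "0 \<le> A"
    by (cases "A_const p \<omega> \<sigma>") auto
  show thesis
  proof (rule that[of "A powr p"])
    fix c :: 'a and h :: real assume h: "0 < h"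
    define V where "V = measure lborel (cell c h)"
    have V: "0 < V" "emeasure lborel (cell c h) = ennreal V"
      using h by (simp_all add: V_def measure_lborel_cell emeasure_lborel_cell)
    define s where "s = measure \<sigma> (cell c h) / V"
    define o' where "o' = measure \<omega> (cell c h) / V"
    have nn: "0 \<le> s" "0 \<le> o'" using V by (simp_all add: s_def o'_def)
    have "ennpowr (emeasure \<omega> (cell c h) / emeasure lborel (cell c h)) (1 / p) *
          ennpowr (emeasure \<sigma> (cell c h) / emeasure lborel (cell c h)) (1 / conj_exponent p) \<le> ennreal A"
      unfolding A(1)[symmetric] A_const_def using h by (intro SUP_upper cell_in_cubes)
    moreover have "emeasure \<omega> (cell c h) / emeasure lborel (cell c h) = ennreal o'"
      "emeasure \<sigma> (cell c h) / emeasure lborel (cell c h) = ennreal s"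
      using V by (simp_all add: o'_def s_def emeasure_radon_eq radon bounded_cell divide_ennreal)
    ultimately have "ennreal (o' powr (1 / p) * s powr (1 / conj_exponent p)) \<le> ennreal A"
      using nn by (simp add: ennpowr_def ennreal_mult)
    then have "o' powr (1 / p) * s powr (1 / conj_exponent p) \<le> A"
      using A(2) by simp
    then have "(o' powr (1 / p) * s powr (1 / conj_exponent p)) powr p \<le> A powr p"
      using p by (intro powr_mono2) auto
    moreover have "1 / conj_exponent p * p = p - 1"
      using p by (simp add: conj_exponent_def)
    ultimately have le: "o' * s powr (p - 1) \<le> A powr p"
      using p nn by (simp add: powr_mult powr_powr)
    have "s powr p * measure \<omega> (cell c h) = o' * s powr (p - 1) * (s * V)"
    proof (cases "s = 0")
      case False
      then have "s powr p = s powr (p - 1) * s"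
        using nn by (simp add: powr_diff)
      then show ?thesis using V by (simp add: o'_def)
    qed (use p in simp)
    also have "\<dots> \<le> A powr p * (s * V)"
      using le nn V by (intro mult_right_mono) auto
    also have "s * V = measure \<sigma> (cell c h)" using V by (simp add: s_def)
    finally show "(measure \<sigma> (cell c h) / measure lborel (cell c h)) powr p * measure \<omega> (cell c h)
       \<le> A powr p * measure \<sigma> (cell c h)"
      by (simp add: s_def V_def)
  qed simp
qed

section \<open>Poisson-type integrals and averages\<close>

definition cell_average :: "'a::euclidean_space measure \<Rightarrow> 'a \<Rightarrow> real \<Rightarrow> real" where
  "cell_average \<mu> c h = measure \<mu> (cell c h) / measure lborel (cell c h)"

lemma cell_average_nonneg: "0 \<le> cell_average \<mu> c h"
  by (simp add: cell_average_def)

text \<open>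
  Split \<open>I\<^sub>0\<close> into annuli around \<open>I\<close> of radii \<open>h\<^sub>k = 2\<^sup>k s\<close>. On the \<open>k\<close>-th annulus the kernel is at most
  \<open>16\<^sup>n 2\<^sup>-\<^sup>k\<close> divided by the volume of \<open>cell c h\<^sub>k\<close>, so \<open>P\<close> is dominated by a geometrically weighted sum
  of averages of \<open>\<sigma>\<close> over concentric cubes, and thus by the largest of them. The largest average is
  also at least a fixed fraction of the average over \<open>I\<^sub>0\<close>, because the last concentric cube contains
  \<open>I\<^sub>0\<close> and is at most four times as wide. This lower bound provides the starting level of the
  summation over levels.
\<close>

lemma P_int_le_average:
  fixes c c\<^sub>0 :: "'a::euclidean_space"
  assumes radon: "radon_measure \<sigma>" and s: "0 < s" and S: "0 < S" and sub: "cell c s \<subseteq> cell c\<^sub>0 S"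
  obtains h where "s \<le> h" "h \<le> 4 * S"
    "P_int (cell c s) (density \<sigma> (indicator (cell c\<^sub>0 S)))
       \<le> ennreal (2 * 16 ^ DIM('a) * cell_average \<sigma> c h)"
    "cell_average \<sigma> c\<^sub>0 S \<le> 4 ^ DIM('a) * cell_average \<sigma> c h"
proof -
  define n where "n = DIM('a)"
  have n: "0 < n" by (simp add: n_def)
  have c: "c \<in> cell c\<^sub>0 S" using sub center_in_cell[OF s] by blast
  have sS: "s \<le> S" using s S sub by (rule cell_half_side_le)
  define h where "h k = 2 ^ k * s" for k :: nat
  have h: "0 < h k" "s \<le> h k" for k using s by (auto simp: h_def)
  have hmono: "h k \<le> h l" if "k \<le> l" for k l
    using that s by (simp add: h_def)
  obtain N where N: "2 * S \<le> h N" "h N \<le> 4 * S"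
  proof -
    have ex: "\<exists>k. 2 * S \<le> h k"
      using real_arch_pow[of 2 "2 * S / s"] s by (auto simp: h_def field_simps intro: less_imp_le)
    define N where "N = (LEAST k. 2 * S \<le> h k)"
    have 1: "2 * S \<le> h N" unfolding N_def using ex by (rule LeastI_ex)
    have "N \<noteq> 0" using 1 sS S by (intro notI) (simp add: h_def)
    then obtain m where m: "N = Suc m" by (cases N) auto
    have "\<not> 2 * S \<le> h m" using not_less_Least[of m "\<lambda>k. 2 * S \<le> h k"] m unfolding N_def by simp
    then have "h N \<le> 4 * S" using m by (simp add: h_def mult.commute)
    with 1 show thesis by (rule that)
  qed
  have cover: "cell c\<^sub>0 S \<subseteq> cell c (h N)"
    using cell_subset_recentered_cell[OF c] cell_mono[OF N(1), of c] by blast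
  define a where "a k = 16 ^ n * (1 / 2) ^ k / (2 * h k) ^ n" for k
  have a: "0 \<le> a k" for k using h[of k] by (simp add: a_def)
  define ker where "ker y = (2 * s / (2 * s + infdist y (cell c s))\<^sup>2) ^ n" for y
  have ker: "ker y \<le> (\<Sum>k\<le>N. a k * indicator (cell c (h k)) y)" if y: "y \<in> cell c\<^sub>0 S" for y
  proof -
    define d where "d = infdist y (cell c s)"
    have d: "0 \<le> d" by (simp add: d_def infdist_nonneg)
    define k where "k = (LEAST k. y \<in> cell c (h k))"
    have yN: "y \<in> cell c (h N)" using y cover by blast
    have yk: "y \<in> cell c (h k)" unfolding k_def using yN by (rule LeastI)
    have kN: "k \<le> N" unfolding k_def using yN by (rule Least_le)
    \<comment> \<open>for \<open>k > 0\<close> because \<open>y\<close> lies outside the previous cube, whose half side is \<open>h k / 2\<close>\<close>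
    have dist: "h k / 2 \<le> 2 * s + d"
    proof (cases k)
      case 0
      then show ?thesis using s d by (simp add: h_def)
    next
      case (Suc m)
      then have "y \<notin> cell c (h m)"
        using not_less_Least[of m "\<lambda>k. y \<in> cell c (h k)"] unfolding k_def by simp
      then have "h m - s \<le> d" unfolding d_def by (rule infdist_cell_ge[OF s])
      then show ?thesis using Suc s by (simp add: h_def)
    qed
    have "2 * s / (2 * s + d)\<^sup>2 \<le> 2 * s / (h k / 2)\<^sup>2"
      using dist s d h[of k] by (intro divide_left_mono power_mono mult_pos_pos zero_less_power) auto
    also have "\<dots> = 16 * (1 / 2) ^ k / (2 * h k)"
      using s by (simp add: h_def field_simps power2_eq_square)
    finally have "ker y \<le> (16 * (1 / 2) ^ k / (2 * h k)) ^ n"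
      unfolding ker_def d_def[symmetric] using s d by (intro power_mono) auto
    also have "\<dots> = 16 ^ n * ((1 / 2) ^ k) ^ n / (2 * h k) ^ n"
      by (simp only: power_mult_distrib power_divide)
    also have "\<dots> \<le> a k"
    proof -
      have "((1 / 2) ^ k) ^ n \<le> ((1 / 2 :: real) ^ k) ^ 1"
        using n by (intro power_decreasing) (auto simp: power_le_one)
      then show ?thesis
        unfolding a_def using h[of k] by (intro divide_right_mono mult_left_mono) auto
    qed
    also have "\<dots> = a k * indicator (cell c (h k)) y" using yk by simp
    also have "\<dots> \<le> (\<Sum>k\<le>N. a k * indicator (cell c (h k)) y)"
      using kN a by (intro member_le_sum) auto
    finally show ?thesis .
  qed
  have sets: "sets \<sigma> = sets borel" using radon by (rule sets_radon)
  have ker_meas: "(\<lambda>y. ennreal (ker y)) \<in> borel_measurable \<sigma>"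
    unfolding ker_def measurable_cong_sets[OF sets refl]
    by (intro measurable_compose[OF _ measurable_ennreal] borel_measurable_power
        borel_measurable_divide borel_measurable_add borel_measurable_const
        borel_measurable_continuous_onI continuous_intros)
  have meas: "(\<lambda>y. ennreal (a k) * indicator (cell c (h k)) y) \<in> borel_measurable \<sigma>" for k
    unfolding measurable_cong_sets[OF sets refl] by measurable
  have "P_int (cell c s) (density \<sigma> (indicator (cell c\<^sub>0 S)))
      = (\<integral>\<^sup>+ y. ennreal (ker y) \<partial>density \<sigma> (indicator (cell c\<^sub>0 S)))"
    by (simp add: P_int_def side_length_cell[OF s] ker_def n_def)
  also have "\<dots> = (\<integral>\<^sup>+ y. indicator (cell c\<^sub>0 S) y * ennreal (ker y) \<partial>\<sigma>)"
    using ker_meas by (intro nn_integral_density borel_measurable_indicator) (auto simp: sets)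
  also have "\<dots> \<le> (\<integral>\<^sup>+ y. (\<Sum>k\<le>N. ennreal (a k) * indicator (cell c (h k)) y) \<partial>\<sigma>)"
  proof (intro nn_integral_mono)
    fix y
    show "indicator (cell c\<^sub>0 S) y * ennreal (ker y) \<le> (\<Sum>k\<le>N. ennreal (a k) * indicator (cell c (h k)) y)"
    proof (cases "y \<in> cell c\<^sub>0 S")
      case True
      have "ennreal (ker y) \<le> ennreal (\<Sum>k\<le>N. a k * indicator (cell c (h k)) y)"
        using ker[OF True] by (rule ennreal_leI)
      also have "\<dots> = (\<Sum>k\<le>N. ennreal (a k * indicator (cell c (h k)) y))"
        using a by (intro sum_ennreal[symmetric]) simp
      also have "\<dots> = (\<Sum>k\<le>N. ennreal (a k) * indicator (cell c (h k)) y)"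
        by (intro sum.cong refl) (simp split: split_indicator)
      finally show ?thesis using True by simp
    qed simp
  qed
  also have "\<dots> = (\<Sum>k\<le>N. ennreal (a k) * emeasure \<sigma> (cell c (h k)))"
    by (subst nn_integral_sum) (auto simp: sets nn_integral_cmult_indicator meas)
  also have "\<dots> = (\<Sum>k\<le>N. ennreal (a k * measure \<sigma> (cell c (h k))))"
    using a by (intro sum.cong refl) (simp add: emeasure_radon_eq[OF radon bounded_cell] ennreal_mult)
  also have "\<dots> = ennreal (\<Sum>k\<le>N. a k * measure \<sigma> (cell c (h k)))"
    using a by (intro sum_ennreal) simp
  also have "(\<Sum>k\<le>N. a k * measure \<sigma> (cell c (h k)))
      = (\<Sum>k\<le>N. 16 ^ n * (1 / 2) ^ k * cell_average \<sigma> c (h k))"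
    using h by (intro sum.cong refl) (simp add: a_def cell_average_def measure_lborel_cell n_def)
  finally have P: "P_int (cell c s) (density \<sigma> (indicator (cell c\<^sub>0 S)))
      \<le> ennreal (\<Sum>k\<le>N. 16 ^ n * (1 / 2) ^ k * cell_average \<sigma> c (h k))" .
  define m where "m = Max ((\<lambda>k. cell_average \<sigma> c (h k)) ` {..N})"
  have "m \<in> (\<lambda>k. cell_average \<sigma> c (h k)) ` {..N}"
    unfolding m_def by (intro Max_in) auto
  then obtain k where k: "k \<le> N" "m = cell_average \<sigma> c (h k)" by auto
  have le_m: "cell_average \<sigma> c (h j) \<le> m" if "j \<le> N" for j
    unfolding m_def using that by (intro Max_ge) auto
  have m: "0 \<le> m" by (simp add: k(2) cell_average_nonneg)
  show thesis
  proof (rule that[of "h k"])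
    show "s \<le> h k" by (rule h)
    show "h k \<le> 4 * S" using hmono[OF k(1)] N(2) by linarith
    have "(\<Sum>k\<le>N. 16 ^ n * (1 / 2) ^ k * cell_average \<sigma> c (h k)) \<le> (\<Sum>k\<le>N. 16 ^ n * (1 / 2) ^ k * m)"
      using le_m by (intro sum_mono mult_left_mono) auto
    also have "\<dots> = (\<Sum>k\<le>N. (1 / 2) ^ k) * (16 ^ n * m)"
      by (simp only: sum_distrib_right) (simp add: ac_simps)
    also have "\<dots> \<le> 2 * (16 ^ n * m)"
      using m by (intro mult_right_mono) (auto simp: sum_gp0)
    finally show "P_int (cell c s) (density \<sigma> (indicator (cell c\<^sub>0 S)))
       \<le> ennreal (2 * 16 ^ DIM('a) * cell_average \<sigma> c (h k))"
      using P by (auto simp: k(2) n_def mult.assoc intro: order_trans ennreal_leI)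
    have "measure \<sigma> (cell c\<^sub>0 S) / (2 * S) ^ n \<le> measure \<sigma> (cell c (h N)) / (2 * S) ^ n"
      using S cover by (intro divide_right_mono radon_measure_mono[OF radon] bounded_cell) auto
    also have "\<dots> = 4 ^ n * (measure \<sigma> (cell c (h N)) / (4 * (2 * S)) ^ n)"
      by (simp only: power_mult_distrib[of 4 "2 * S"]) simp
    also have "\<dots> \<le> 4 ^ n * (measure \<sigma> (cell c (h N)) / (2 * h N) ^ n)"
      using N(2) h[of N] S by (intro mult_left_mono divide_left_mono power_mono mult_pos_pos zero_less_power) auto
    also have "\<dots> \<le> 4 ^ n * m"
      using le_m[of N] h[of N]
      by (intro mult_left_mono) (simp_all add: cell_average_def measure_lborel_cell n_def)
    finally show "cell_average \<sigma> c\<^sub>0 S \<le> 4 ^ DIM('a) * cell_average \<sigma> c (h k)"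
      using S unfolding k(2)[symmetric] by (simp add: cell_average_def measure_lborel_cell n_def)
  qed
qed

section \<open>Level sets of the averages\<close>

text \<open>
  The heart of the argument. All members of \<open>F\<close> sit in cubes on which the average of \<open>\<sigma>\<close> is at least \<open>T\<close>.
  Choose a disjoint Vitali subfamily of Euclidean balls around these cubes and let \<open>E\<close> be their union.

  \<^item> By doubling and the \<open>A\<^sub>p\<close> bound, \<open>T\<^sup>p\<close> times the \<open>\<omega>\<close>-mass of \<open>F\<close> is at most a constant times \<open>\<sigma>(E)\<close>.
  \<^item> The averages being at least \<open>T\<close>, the volume of \<open>E\<close> is at most a constant times \<open>\<sigma>(I\<^sub>0) / T\<close> (weak
    type \<open>(1,1)\<close>). So \<open>E\<close> is a small part of a fixed dilate of \<open>I\<^sub>0\<close> when \<open>T\<close> is large compared with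
    the average over \<open>I\<^sub>0\<close>, and \<open>A\<^sub>\<infinity>\<close> turns smallness in volume into smallness in \<open>\<sigma>\<close>.

  The resulting factor \<open>(average / T)\<^sup>\<epsilon>\<close> is what makes the sum over levels converge.
\<close>

lemma level_family_bound:
  fixes \<omega> \<sigma> :: "'a::euclidean_space measure"
  assumes radon: "radon_measure \<omega>" "radon_measure \<sigma>" and p: "1 < p" and C: "0 < C" "0 < \<epsilon>" and K: "0 \<le> K"
    and A_inf: "\<And>c h E. 0 < h \<Longrightarrow> E \<in> sets borel \<Longrightarrow> E \<subseteq> cell c h \<Longrightarrow>
      measure \<sigma> E \<le> C * (measure lborel E / measure lborel (cell c h)) powr \<epsilon> * measure \<sigma> (cell c h)"
    and A_p: "\<And>c h. 0 < h \<Longrightarrow> cell_average \<sigma> c h powr p * measure \<omega> (cell c h) \<le> K * measure \<sigma> (cell c h)"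
  shows "\<exists>M\<ge>0. \<forall>c\<^sub>0 S T F c h. finite F \<and> disjoint F \<and> F \<subseteq> sets borel \<and> 0 < S \<and> 0 < T \<and>
      (\<forall>I\<in>F. 0 < h I \<and> h I \<le> 4 * S \<and> c I \<in> cell c\<^sub>0 S \<and> I \<subseteq> cell (c I) (h I) \<and>
         T \<le> cell_average \<sigma> (c I) (h I)) \<longrightarrow>
      T powr p * (\<Sum>I\<in>F. measure \<omega> I)
        \<le> M * (cell_average \<sigma> c\<^sub>0 S / T) powr \<epsilon> * measure \<sigma> (cell c\<^sub>0 S)"
proof -
  define n where "n = DIM('a)"
  have n: "0 < n" by (simp add: n_def)
  have "\<exists>D>0. \<forall>c h. 0 < h \<longrightarrow> measure \<sigma> (cell c (t * h)) \<le> D * measure \<sigma> (cell c h)" for t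
    by (rule A_infty_doubling[OF radon(2) C A_inf])
  then obtain D where D: "\<And>t. 0 < D t"
    "\<And>t c h. 0 < h \<Longrightarrow> measure \<sigma> (cell c (t * h)) \<le> D t * measure \<sigma> (cell c h)" by metis
  \<comment> \<open>The \<open>J\<close>-fold dilate of \<open>I\<^sub>0 = cell c\<^sub>0 S\<close> contains all Vitali balls; the \<open>R\<close>-fold dilate of a selected cube
    contains the ball around it enlarged five times. \<open>L\<close> is the price for passing from \<open>\<omega>\<close> to \<open>\<sigma>\<close> on
    such a dilate, and \<open>G\<close> the constant in the weak type \<open>(1,1)\<close> bound.\<close>
  define J where "J = 9 * real n"
  define R where "R = 10 * real n"
  define L where "L = R powr (real n * p) * K * D R"
  define G where "G = (2 * real n) ^ n * D J / J ^ n"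
  have pos: "0 < J" "0 < R" "0 \<le> L" "0 < G"
    using n K D(1) by (simp_all add: J_def R_def L_def G_def less_imp_le)
  show ?thesis
  proof (intro exI[of _ "L * C * G powr \<epsilon> * D J"] conjI allI impI)
    show "0 \<le> L * C * G powr \<epsilon> * D J" using pos C D(1)[of J] by simp
    fix c\<^sub>0 S T and F :: "'a set set" and c h
    assume "finite F \<and> disjoint F \<and> F \<subseteq> sets borel \<and> 0 < S \<and> 0 < T \<and>
      (\<forall>I\<in>F. 0 < h I \<and> h I \<le> 4 * S \<and> c I \<in> cell c\<^sub>0 S \<and> I \<subseteq> cell (c I) (h I) \<and>
         T \<le> cell_average \<sigma> (c I) (h I))"
    then have F: "finite F" "disjoint F" "F \<subseteq> sets borel" and S: "0 < S" and T: "0 < T"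
      and h: "\<And>I. I \<in> F \<Longrightarrow> 0 < h I" "\<And>I. I \<in> F \<Longrightarrow> h I \<le> 4 * S"
      and c: "\<And>I. I \<in> F \<Longrightarrow> c I \<in> cell c\<^sub>0 S" and I: "\<And>I. I \<in> F \<Longrightarrow> I \<subseteq> cell (c I) (h I)"
      and avg: "\<And>I. I \<in> F \<Longrightarrow> T \<le> cell_average \<sigma> (c I) (h I)"
      by auto
    \<comment> \<open>large enough for the ball to contain the cube, yet within a fixed dilate of it\<close>
    define \<rho> where "\<rho> I = 2 * real n * h I" for I
    have \<rho>: "0 < \<rho> I" "\<rho> I \<le> 2 * real n * (4 * S)" "h I \<le> \<rho> I" if "I \<in> F" for I
      using h[OF that] n unfolding \<rho>_def by (auto intro!: mult_left_mono simp del: mult_le_cancel_left)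
    have in_ball: "cell (c I) (h I) \<subseteq> ball (c I) (\<rho> I)" if "I \<in> F" for I
      using cell_subset_ball[OF h(1)[OF that], of "c I"] by (simp add: \<rho>_def n_def)
    have "(\<Union>I\<in>F. cell (c I) (h I)) \<subseteq> (\<Union>I\<in>F. ball (c I) (\<rho> I))"
      using in_ball by blast
    then obtain X where X: "X \<subseteq> F" "pairwise (\<lambda>I I'. disjnt (ball (c I) (\<rho> I)) (ball (c I') (\<rho> I'))) X"
      and cov: "(\<Union>I\<in>F. cell (c I) (h I)) \<subseteq> (\<Union>I\<in>X. ball (c I) (5 * \<rho> I))"
      by (rule Vitali_covering_lemma_balls[where B = "2 * real n * (4 * S)"]) (use \<rho> in auto)
    have finX: "finite X" using X(1) F(1) by (rule finite_subset)
    have disjX: "disjoint_family_on (\<lambda>I. ball (c I) (\<rho> I)) X"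
      using X(2) by (auto simp: disjoint_family_on_def pairwise_def disjnt_def)
    define E where "E = (\<Union>I\<in>X. ball (c I) (\<rho> I))"
    have E_borel: "E \<in> sets borel" unfolding E_def by (intro borel_open) auto
    have E_sub: "E \<subseteq> cell c\<^sub>0 (J * S)"
    proof -
      have "ball (c I) (\<rho> I) \<subseteq> cell c\<^sub>0 (J * S)" if I: "I \<in> F" for I
      proof -
        have "ball (c I) (\<rho> I) \<subseteq> cell c\<^sub>0 (S + \<rho> I)"
          using ball_subset_cell[of "c I" "\<rho> I"] cell_subset_shifted_cell[OF c[OF I], of "\<rho> I"] by blast
        also have "\<dots> \<subseteq> cell c\<^sub>0 (J * S)"
        proof (rule cell_mono)
          have "S \<le> real n * S" using n S by simp
          then show "S + \<rho> I \<le> J * S" using \<rho>(2)[OF I] by (simp add: J_def)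
        qed
        finally show ?thesis .
      qed
      then show ?thesis using X(1) by (auto simp: E_def)
    qed
    have measE: "measure \<mu> E = (\<Sum>I\<in>X. measure \<mu> (ball (c I) (\<rho> I)))"
      if "sets \<mu> = sets borel" "\<And>c r. emeasure \<mu> (ball c r) \<noteq> \<infinity>" for \<mu> :: "'a measure"
      unfolding E_def using finX disjX that by (intro measure_finite_Union) auto
    have measE_\<sigma>: "measure \<sigma> E = (\<Sum>I\<in>X. measure \<sigma> (ball (c I) (\<rho> I)))"
      using radon_bounded_finite[OF radon(2) bounded_ball] by (intro measE) (auto simp: sets_radon[OF radon(2)] less_top)
    have measE_leb: "measure lborel E = (\<Sum>I\<in>X. measure lborel (ball (c I) (\<rho> I)))"
      using emeasure_lborel_ball_finite by (intro measE) (auto simp: less_top)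
    have mono_ball: "measure \<sigma> (cell (c I) (h I)) \<le> measure \<sigma> (ball (c I) (\<rho> I))" if "I \<in> X" for I
      using that X(1) by (intro radon_measure_mono[OF radon(2)] in_ball) auto
    have \<sigma>J: "measure \<sigma> (cell c\<^sub>0 (J * S)) \<le> D J * measure \<sigma> (cell c\<^sub>0 S)"
      using S by (rule D(2))

    \<comment> \<open>weak type \<open>(1,1)\<close>: the volume of \<open>E\<close> is controlled by \<open>\<sigma>(E) / T\<close>, hence by \<open>\<sigma>(I\<^sub>0) / T\<close>\<close>
    have "T * measure lborel E \<le> (\<Sum>I\<in>X. (2 * real n) ^ n * measure \<sigma> (ball (c I) (\<rho> I)))"
      unfolding measE_leb sum_distrib_left
    proof (rule sum_mono)
      fix I assume IX: "I \<in> X"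
      then have IF: "I \<in> F" using X(1) by blast
      have "measure lborel (ball (c I) (\<rho> I)) \<le> measure lborel (cell (c I) (\<rho> I))"
        using \<rho>[OF IF] by (intro measure_mono_fmeasurable ball_subset_cell) (auto simp: fmeasurable_def emeasure_lborel_cell)
      also have "\<dots> = (2 * real n * (2 * h I)) ^ n"
        using \<rho>[OF IF] by (simp add: measure_lborel_cell n_def \<rho>_def ac_simps)
      also have "\<dots> = (2 * real n) ^ n * measure lborel (cell (c I) (h I))"
        using h[OF IF] by (subst power_mult_distrib) (simp add: measure_lborel_cell n_def)
      finally have "T * measure lborel (ball (c I) (\<rho> I))
          \<le> T * ((2 * real n) ^ n * measure lborel (cell (c I) (h I)))"
        using T by simp
      also have "\<dots> = (2 * real n) ^ n * (T * measure lborel (cell (c I) (h I)))" by simp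
      also have "\<dots> \<le> (2 * real n) ^ n * measure \<sigma> (cell (c I) (h I))"
        using avg[OF IF] h[OF IF]
        by (intro mult_left_mono) (simp_all add: cell_average_def measure_lborel_cell pos_le_divide_eq)
      also have "\<dots> \<le> (2 * real n) ^ n * measure \<sigma> (ball (c I) (\<rho> I))"
        using mono_ball[OF IX] by (intro mult_left_mono) auto
      finally show "T * measure lborel (ball (c I) (\<rho> I)) \<le> (2 * real n) ^ n * measure \<sigma> (ball (c I) (\<rho> I))" .
    qed
    also have "\<dots> = (2 * real n) ^ n * measure \<sigma> E"
      by (simp add: measE_\<sigma> sum_distrib_left)
    also have "\<dots> \<le> (2 * real n) ^ n * measure \<sigma> (cell c\<^sub>0 (J * S))"
      using E_sub E_borel by (intro mult_left_mono radon_measure_mono[OF radon(2)] bounded_cell) auto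
    also have "\<dots> \<le> (2 * real n) ^ n * (D J * measure \<sigma> (cell c\<^sub>0 S))"
      using \<sigma>J by (intro mult_left_mono) auto
    finally have "T * measure lborel E \<le> (2 * real n) ^ n * D J * measure \<sigma> (cell c\<^sub>0 S)" by simp
    then have "measure lborel E / measure lborel (cell c\<^sub>0 (J * S)) \<le> G * (cell_average \<sigma> c\<^sub>0 S / T)"
      using T S pos(1) by (simp add: G_def cell_average_def measure_lborel_cell n_def[symmetric] field_simps)
    then have "(measure lborel E / measure lborel (cell c\<^sub>0 (J * S))) powr \<epsilon>
        \<le> (G * (cell_average \<sigma> c\<^sub>0 S / T)) powr \<epsilon>"
      using C by (intro powr_mono2) auto
    also have "\<dots> = G powr \<epsilon> * (cell_average \<sigma> c\<^sub>0 S / T) powr \<epsilon>"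
      using pos T by (subst powr_mult) (simp_all add: cell_average_nonneg)
    finally have ratio: "(measure lborel E / measure lborel (cell c\<^sub>0 (J * S))) powr \<epsilon>
        \<le> G powr \<epsilon> * (cell_average \<sigma> c\<^sub>0 S / T) powr \<epsilon>" .
    have "measure \<sigma> E
        \<le> C * (measure lborel E / measure lborel (cell c\<^sub>0 (J * S))) powr \<epsilon> * measure \<sigma> (cell c\<^sub>0 (J * S))"
      using S pos E_borel E_sub by (intro A_inf) auto
    also have "\<dots> \<le> C * (G powr \<epsilon> * (cell_average \<sigma> c\<^sub>0 S / T) powr \<epsilon>) * (D J * measure \<sigma> (cell c\<^sub>0 S))"
      using ratio \<sigma>J C by (intro mult_mono mult_left_mono) auto
    finally have \<sigma>E: "measure \<sigma> E
        \<le> C * (G powr \<epsilon> * (cell_average \<sigma> c\<^sub>0 S / T) powr \<epsilon>) * (D J * measure \<sigma> (cell c\<^sub>0 S))" .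

    \<comment> \<open>the disjoint members of \<open>F\<close> are covered by the dilated Vitali cubes, on which \<open>A\<^sub>p\<close> applies\<close>
    have "(\<Sum>I\<in>F. measure \<omega> I) = measure \<omega> (\<Union>F)"
    proof -
      have "measure \<omega> (\<Union>I\<in>F. I) = (\<Sum>I\<in>F. measure \<omega> I)"
      proof (rule measure_finite_Union[OF F(1)])
        show "(\<lambda>I. I) ` F \<subseteq> sets \<omega>" using F(3) by (simp add: sets_radon[OF radon(1)])
        show "disjoint_family_on (\<lambda>I. I) F"
          using F(2) by (auto simp: disjoint_family_on_def disjoint_def)
        show "emeasure \<omega> I \<noteq> \<infinity>" if "I \<in> F" for I
          using radon_bounded_finite[OF radon(1) bounded_subset[OF bounded_cell I[OF that]]] by simp
      qed
      then show ?thesis by simp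
    qed
    also have "\<dots> \<le> measure \<omega> (\<Union>I\<in>X. cell (c I) (R * h I))"
    proof (rule measure_mono_fmeasurable)
      have dilate: "ball (c I) (5 * \<rho> I) \<subseteq> cell (c I) (R * h I)" for I
        using ball_subset_cell[of "c I" "5 * \<rho> I"] by (simp add: R_def \<rho>_def mult.assoc)
      have "\<Union>F \<subseteq> (\<Union>I\<in>F. cell (c I) (h I))" using I by fast
      also note cov
      also have "(\<Union>I\<in>X. ball (c I) (5 * \<rho> I)) \<subseteq> (\<Union>I\<in>X. cell (c I) (R * h I))"
        by (intro UN_mono order_refl dilate)
      finally show "\<Union>F \<subseteq> (\<Union>I\<in>X. cell (c I) (R * h I))" .
      show "\<Union>F \<in> sets \<omega>" using F by (intro sets.finite_Union) (auto simp: sets_radon[OF radon(1)])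
      show "(\<Union>I\<in>X. cell (c I) (R * h I)) \<in> fmeasurable \<omega>"
        using finX radon_fmeasurable_cell[OF radon(1)] by (intro fmeasurable.finite_UN) auto
    qed
    also have "\<dots> \<le> (\<Sum>I\<in>X. measure \<omega> (cell (c I) (R * h I)))"
      using finX radon_fmeasurable_cell[OF radon(1)] by (intro measure_UNION_le fmeasurableD)
    finally have "T powr p * (\<Sum>I\<in>F. measure \<omega> I) \<le> T powr p * (\<Sum>I\<in>X. measure \<omega> (cell (c I) (R * h I)))"
      by (intro mult_left_mono) auto
    also have "\<dots> \<le> (\<Sum>I\<in>X. L * measure \<sigma> (ball (c I) (\<rho> I)))"
      unfolding sum_distrib_left
    proof (rule sum_mono)
      fix I assume IX: "I \<in> X"
      then have IF: "I \<in> F" using X(1) by blast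
      let ?Q = "cell (c I) (R * h I)"
      have "1 \<le> R" using n by (simp add: R_def)
      have Rh: "0 < R * h I" "h I \<le> R * h I" using \<open>1 \<le> R\<close> h[OF IF] by auto
      have "T \<le> measure \<sigma> (cell (c I) (h I)) / (2 * h I) ^ n"
        using avg[OF IF] h[OF IF] by (simp add: cell_average_def measure_lborel_cell n_def)
      also have "\<dots> \<le> measure \<sigma> ?Q / (2 * h I) ^ n"
        using h[OF IF] Rh by (intro divide_right_mono radon_measure_mono[OF radon(2)] bounded_cell cell_mono) auto
      also have "\<dots> = R ^ n * cell_average \<sigma> (c I) (R * h I)"
        using Rh pos by (simp add: cell_average_def measure_lborel_cell n_def power_mult_distrib)
      finally have "T powr p \<le> (R ^ n * cell_average \<sigma> (c I) (R * h I)) powr p"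
        using T p by (intro powr_mono2) auto
      also have "\<dots> = R powr (real n * p) * cell_average \<sigma> (c I) (R * h I) powr p"
        using pos by (simp add: powr_mult cell_average_nonneg powr_powr flip: powr_realpow)
      finally have "T powr p * measure \<omega> ?Q
          \<le> R powr (real n * p) * (cell_average \<sigma> (c I) (R * h I) powr p * measure \<omega> ?Q)"
        by (metis mult.assoc mult_right_mono measure_nonneg)
      also have "\<dots> \<le> R powr (real n * p) * (K * measure \<sigma> ?Q)"
        using Rh by (intro mult_left_mono A_p) auto
      also have "\<dots> \<le> R powr (real n * p) * (K * (D R * measure \<sigma> (ball (c I) (\<rho> I))))"
      proof (intro mult_left_mono)
        have "measure \<sigma> ?Q \<le> D R * measure \<sigma> (cell (c I) (h I))"
          using h[OF IF] by (intro D(2))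
        also have "\<dots> \<le> D R * measure \<sigma> (ball (c I) (\<rho> I))"
          using mono_ball[OF IX] D(1)[of R] by (intro mult_left_mono) auto
        finally show "measure \<sigma> ?Q \<le> D R * measure \<sigma> (ball (c I) (\<rho> I))" .
      qed (use K in auto)
      finally show "T powr p * measure \<omega> ?Q \<le> L * measure \<sigma> (ball (c I) (\<rho> I))"
        by (simp add: L_def mult.assoc)
    qed
    also have "\<dots> = L * measure \<sigma> E" by (simp add: measE_\<sigma> sum_distrib_left)
    also have "\<dots> \<le> L * (C * (G powr \<epsilon> * (cell_average \<sigma> c\<^sub>0 S / T) powr \<epsilon>) * (D J * measure \<sigma> (cell c\<^sub>0 S)))"
      using \<sigma>E pos by (intro mult_left_mono) auto
    also have "\<dots> = L * C * G powr \<epsilon> * D J * (cell_average \<sigma> c\<^sub>0 S / T) powr \<epsilon> * measure \<sigma> (cell c\<^sub>0 S)"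
      by simp
    finally show "T powr p * (\<Sum>I\<in>F. measure \<omega> I)
        \<le> L * C * G powr \<epsilon> * D J * (cell_average \<sigma> c\<^sub>0 S / T) powr \<epsilon> * measure \<sigma> (cell c\<^sub>0 S)" .
  qed
qed

section \<open>Summation over levels\<close>

text \<open>
  A layer-cake argument: group the indices by the dyadic level \<open>T = 2\<^sup>i B\<close> with \<open>T \<le> v \<le> 2 T\<close>; the decay
  in \<open>T\<close> makes the contributions of the levels a geometric series of ratio \<open>2\<^sup>-\<^sup>\<epsilon>\<close>.
\<close>

lemma sum_powr_le_of_level_decay:
  fixes v w :: "'i \<Rightarrow> real"
  assumes F: "finite F" and B: "0 < B" and p: "0 < p" and \<epsilon>: "0 < \<epsilon>" and M: "0 \<le> M"
    and w: "\<And>I. I \<in> F \<Longrightarrow> 0 \<le> w I" and v: "\<And>I. I \<in> F \<Longrightarrow> B \<le> v I"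
    and decay: "\<And>T. B \<le> T \<Longrightarrow> T powr p * (\<Sum>I | I \<in> F \<and> T \<le> v I. w I) \<le> M * (B / T) powr \<epsilon>"
  shows "(\<Sum>I\<in>F. w I * v I powr p) \<le> 2 powr p * M / (1 - 2 powr - \<epsilon>)"
proof -
  define T where "T i = 2 ^ i * B" for i :: nat
  have T: "0 < T i" "B \<le> T i" for i using B by (simp_all add: T_def)
  have "\<exists>i. T i \<le> v I \<and> v I \<le> 2 * T i" if I: "I \<in> F" for I
  proof -
    have ex: "\<exists>i. v I < T (Suc i)"
    proof -
      obtain i where "v I / B < 2 ^ i" using real_arch_pow[of 2 "v I / B"] by auto
      also have "(2::real) ^ i \<le> 2 ^ Suc i" by simp
      finally show ?thesis using B by (auto simp: T_def pos_divide_less_eq)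
    qed
    define i where "i = (LEAST i. v I < T (Suc i))"
    have 1: "v I < T (Suc i)" unfolding i_def using ex by (rule LeastI_ex)
    have "T i \<le> v I"
    proof (cases i)
      case 0
      then show ?thesis using v[OF I] by (simp add: T_def)
    next
      case (Suc j)
      then show ?thesis
        using not_less_Least[of j "\<lambda>i. v I < T (Suc i)"] unfolding i_def by simp
    qed
    with 1 show ?thesis by (auto simp: T_def intro!: exI[of _ i])
  qed
  then obtain i where i: "\<And>I. I \<in> F \<Longrightarrow> T (i I) \<le> v I \<and> v I \<le> 2 * T (i I)" by metis
  obtain N where N: "\<And>I. I \<in> F \<Longrightarrow> i I < N"
    using finite_nat_set_iff_bounded[of "i ` F"] F by auto
  have "(\<Sum>I\<in>F. w I * v I powr p) \<le> (\<Sum>I\<in>F. \<Sum>j<N. if T j \<le> v I then w I * (2 * T j) powr p else 0)"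
  proof (rule sum_mono)
    fix I assume I: "I \<in> F"
    have "w I * v I powr p \<le> w I * (2 * T (i I)) powr p"
      using i[OF I] w[OF I] v[OF I] B p by (intro mult_left_mono powr_mono2) auto
    also have "\<dots> = (if T (i I) \<le> v I then w I * (2 * T (i I)) powr p else 0)"
      using i[OF I] by simp
    also have "\<dots> \<le> (\<Sum>j<N. if T j \<le> v I then w I * (2 * T j) powr p else 0)"
      using N[OF I] w[OF I] by (intro member_le_sum) auto
    finally show "w I * v I powr p \<le> (\<Sum>j<N. if T j \<le> v I then w I * (2 * T j) powr p else 0)" .
  qed
  also have "\<dots> = (\<Sum>j<N. \<Sum>I\<in>F. if T j \<le> v I then w I * (2 * T j) powr p else 0)"
    by (rule sum.swap)
  also have "\<dots> = (\<Sum>j<N. 2 powr p * (T j powr p * (\<Sum>I | I \<in> F \<and> T j \<le> v I. w I)))"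
  proof (rule sum.cong[OF refl])
    fix j
    have "(\<Sum>I\<in>F. if T j \<le> v I then w I * (2 * T j) powr p else 0)
        = (\<Sum>I | I \<in> F \<and> T j \<le> v I. w I * (2 * T j) powr p)"
      using F by (simp add: sum.inter_filter)
    also have "\<dots> = 2 powr p * (T j powr p * (\<Sum>I | I \<in> F \<and> T j \<le> v I. w I))"
      using T[of j] by (simp add: powr_mult sum_distrib_left ac_simps)
    finally show "(\<Sum>I\<in>F. if T j \<le> v I then w I * (2 * T j) powr p else 0)
        = 2 powr p * (T j powr p * (\<Sum>I | I \<in> F \<and> T j \<le> v I. w I))" .
  qed
  also have "\<dots> \<le> (\<Sum>j<N. 2 powr p * (M * (2 powr - \<epsilon>) ^ j))"
  proof (intro sum_mono mult_left_mono)
    fix j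
    have "B / T j = 2 powr - real j"
      using B by (simp add: T_def powr_minus powr_realpow divide_inverse)
    then have "(B / T j) powr \<epsilon> = (2 powr - \<epsilon>) ^ j"
      by (simp add: powr_powr powr_realpow[symmetric] mult.commute)
    with decay[OF T(2)[of j]]
    show "T j powr p * (\<Sum>I | I \<in> F \<and> T j \<le> v I. w I) \<le> M * (2 powr - \<epsilon>) ^ j" by simp
  qed simp
  also have "\<dots> = 2 powr p * M * (\<Sum>j<N. (2 powr - \<epsilon>) ^ j)"
    by (simp add: sum_distrib_left mult.assoc)
  also have "\<dots> \<le> 2 powr p * M * (1 / (1 - 2 powr - \<epsilon>))"
  proof (intro mult_left_mono)
    have "2 powr - \<epsilon> < 2 powr (0::real)" using \<epsilon> by (intro powr_less_mono) auto
    then have "norm (2 powr - \<epsilon>) < 1" by simp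
    then have "(\<lambda>j. (2 powr - \<epsilon>) ^ j) sums (1 / (1 - 2 powr - \<epsilon>))"
      by (rule geometric_sums)
    then show "(\<Sum>j<N. (2 powr - \<epsilon>) ^ j) \<le> 1 / (1 - 2 powr - \<epsilon>)"
      using sum_le_suminf[of "\<lambda>j. (2 powr - \<epsilon>) ^ j" "{..<N}"] by (simp add: sums_iff)
  qed (use M in simp)
  finally show ?thesis by simp
qed

section \<open>The pivotal condition\<close>

theorem corollary2:
  fixes p :: real and \<omega> \<sigma> :: "'a::euclidean_space measure"
  assumes "1 < p"
    and "radon_measure \<omega>" and "radon_measure \<sigma>"
    and "A_infty \<sigma>"
    and "A_const p \<omega> \<sigma> < \<infinity>"
  shows "pivotal_condition p \<omega> \<sigma>"
proof -
  note p = assms(1) and radon = assms(2,3)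
  define n where "n = DIM('a)"
  obtain C \<epsilon> where C: "0 < C" "0 < \<epsilon>"
    and A_inf: "\<And>c h E. 0 < h \<Longrightarrow> E \<in> sets borel \<Longrightarrow> E \<subseteq> cell c h \<Longrightarrow>
      measure \<sigma> E \<le> C * (measure lborel E / measure lborel (cell c h)) powr \<epsilon> * measure \<sigma> (cell c h)"
    using A_infty_measure_bound[OF assms(3,4)] by blast
  obtain K where K: "0 \<le> K"
    and A_p: "\<And>c h. 0 < h \<Longrightarrow> cell_average \<sigma> c h powr p * measure \<omega> (cell c h) \<le> K * measure \<sigma> (cell c h)"
    using A_const_measure_bound[OF assms(1-3,5)] unfolding cell_average_def by blast
  obtain M where M: "0 \<le> M" and level: "\<And>c\<^sub>0 S T F c h. finite F \<and> disjoint F \<and> F \<subseteq> sets borel \<and> 0 < S \<and> 0 < T \<and>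
      (\<forall>I\<in>F. 0 < h I \<and> h I \<le> 4 * S \<and> c I \<in> cell c\<^sub>0 S \<and> I \<subseteq> cell (c I) (h I) \<and>
         T \<le> cell_average \<sigma> (c I) (h I)) \<Longrightarrow>
      T powr p * (\<Sum>I\<in>F. measure \<omega> I)
        \<le> M * (cell_average \<sigma> c\<^sub>0 S / T) powr \<epsilon> * measure \<sigma> (cell c\<^sub>0 S)"
    using level_family_bound[OF radon p C K A_inf A_p] by blast
  define a :: real where "a = 2 * 16 ^ n"
  have a: "0 < a" by (simp add: a_def)
  define W where "W = a powr p * (2 powr p * (M * 4 powr (n * \<epsilon>)) / (1 - 2 powr - \<epsilon>))"
  have main: "(\<Sum>\<^sub>\<infinity>I\<in>\<I>. emeasure \<omega> I * ennpowr (P_int I (density \<sigma> (indicator I\<^sub>0))) p)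
          / emeasure \<sigma> I\<^sub>0 \<le> ennreal W"
    if dec: "(I\<^sub>0, \<I>) \<in> cube_decompositions" and nz: "emeasure \<sigma> I\<^sub>0 \<noteq> 0" for I\<^sub>0 \<I>
  proof -
    from dec have I0: "I\<^sub>0 \<in> cubes" and \<I>: "\<I> \<subseteq> cubes" "partition_on I\<^sub>0 \<I>"
      by (auto simp: cube_decompositions_def)
    from I0 obtain c\<^sub>0 S where S: "0 < S" and I0_eq: "I\<^sub>0 = cell c\<^sub>0 S" by (rule cubes_cellE)
    define s0 where "s0 = measure \<sigma> I\<^sub>0"
    have s0: "emeasure \<sigma> I\<^sub>0 = ennreal s0"
      unfolding s0_def I0_eq by (rule emeasure_radon_eq[OF radon(2) bounded_cell])
    have s0_pos: "0 < s0" using nz by (simp add: s0 ennreal_eq_0_iff)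
    define B where "B = cell_average \<sigma> c\<^sub>0 S / 4 ^ n"
    have B: "0 < B"
      using s0_pos S by (simp add: B_def cell_average_def measure_lborel_cell s0_def I0_eq)
    have "\<exists>c h. 0 < h \<and> h \<le> 4 * S \<and> c \<in> cell c\<^sub>0 S \<and> I \<subseteq> cell c h \<and> B \<le> cell_average \<sigma> c h \<and>
        P_int I (density \<sigma> (indicator I\<^sub>0)) \<le> ennreal (a * cell_average \<sigma> c h)" if I: "I \<in> \<I>" for I
    proof -
      from I \<I>(1) have "I \<in> cubes" by blast
      then obtain c s where s: "0 < s" and I_eq: "I = cell c s" by (rule cubes_cellE)
      have sub: "cell c s \<subseteq> cell c\<^sub>0 S"
        using I \<I>(2) I_eq I0_eq by (auto simp: partition_on_def)
      obtain h where h: "s \<le> h" "h \<le> 4 * S"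
        "P_int (cell c s) (density \<sigma> (indicator (cell c\<^sub>0 S))) \<le> ennreal (a * cell_average \<sigma> c h)"
        "cell_average \<sigma> c\<^sub>0 S \<le> 4 ^ n * cell_average \<sigma> c h"
        using P_int_le_average[OF radon(2) s S sub] unfolding a_def n_def by blast
      have "B \<le> cell_average \<sigma> c h" using h(4) by (simp add: B_def pos_divide_le_eq mult.commute)
      then show ?thesis
        using h s sub center_in_cell[OF s, of c] cell_mono[OF h(1), of c]
        unfolding I_eq I0_eq by (intro exI[of _ c] exI[of _ h]) auto
    qed
    then obtain c h where ch: "\<And>I. I \<in> \<I> \<Longrightarrow> 0 < h I \<and> h I \<le> 4 * S \<and> c I \<in> cell c\<^sub>0 S \<and> I \<subseteq> cell (c I) (h I) \<and>
        B \<le> cell_average \<sigma> (c I) (h I)"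
      and P: "\<And>I. I \<in> \<I> \<Longrightarrow> P_int I (density \<sigma> (indicator I\<^sub>0)) \<le> ennreal (a * cell_average \<sigma> (c I) (h I))"
      by metis
    define v where "v I = cell_average \<sigma> (c I) (h I)" for I
    \<comment> \<open>the sum over the decomposition is the supremum of its finite partial sums\<close>
    have finite_bound: "(\<Sum>I\<in>F. emeasure \<omega> I * ennpowr (P_int I (density \<sigma> (indicator I\<^sub>0))) p)
        \<le> ennreal (s0 * W)" if F: "finite F" "F \<subseteq> \<I>" for F
    proof -
      have F_borel: "F \<subseteq> sets borel" using F(2) \<I>(1) by (auto elim!: cubes_cellE)
      have "(\<Sum>I\<in>F. emeasure \<omega> I * ennpowr (P_int I (density \<sigma> (indicator I\<^sub>0))) p)
          \<le> (\<Sum>I\<in>F. ennreal (a powr p * (measure \<omega> I * v I powr p)))"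
      proof (rule sum_mono)
        fix I assume "I \<in> F"
        then have I: "I \<in> \<I>" using F(2) by blast
        have v: "0 \<le> v I" by (simp add: v_def cell_average_nonneg)
        obtain x where x: "P_int I (density \<sigma> (indicator I\<^sub>0)) = ennreal x" "0 \<le> x" "x \<le> a * v I"
          using P[OF I] v a unfolding v_def[symmetric]
          by (cases "P_int I (density \<sigma> (indicator I\<^sub>0))") (auto simp: top_unique)
        have "ennpowr (P_int I (density \<sigma> (indicator I\<^sub>0))) p = ennreal (x powr p)"
          using x by (simp add: ennpowr_def)
        also have "\<dots> \<le> ennreal ((a * v I) powr p)"
          using x p by (intro ennreal_leI powr_mono2) auto
        also have "(a * v I) powr p = a powr p * v I powr p"
          using a v by (simp add: powr_mult)
        finally have "emeasure \<omega> I * ennpowr (P_int I (density \<sigma> (indicator I\<^sub>0))) p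
            \<le> ennreal (measure \<omega> I) * ennreal (a powr p * v I powr p)"
          using emeasure_radon_eq[OF radon(1) bounded_subset[OF bounded_cell, of I]] ch[OF I]
          by (metis mult_left_mono zero_le)
        also have "\<dots> = ennreal (a powr p * (measure \<omega> I * v I powr p))"
          by (simp add: ennreal_mult[symmetric] ac_simps)
        finally show "emeasure \<omega> I * ennpowr (P_int I (density \<sigma> (indicator I\<^sub>0))) p
            \<le> ennreal (a powr p * (measure \<omega> I * v I powr p))" .
      qed
      also have "\<dots> = ennreal (a powr p * (\<Sum>I\<in>F. measure \<omega> I * v I powr p))"
        by (simp add: sum_distrib_left)
      also have "\<dots> \<le> ennreal (a powr p * (2 powr p * (M * 4 powr (n * \<epsilon>) * s0) / (1 - 2 powr - \<epsilon>)))"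
      proof (intro ennreal_leI mult_left_mono sum_powr_le_of_level_decay[OF F(1) B])
        fix T assume T: "B \<le> T"
        have "T powr p * (\<Sum>I | I \<in> F \<and> T \<le> v I. measure \<omega> I)
            \<le> M * (cell_average \<sigma> c\<^sub>0 S / T) powr \<epsilon> * measure \<sigma> (cell c\<^sub>0 S)"
        proof (rule level[of _ _ _ h c], intro conjI ballI)
          show "disjoint {I \<in> F. T \<le> v I}"
            using \<I>(2) F(2) by (auto simp: partition_on_def disjoint_def)
        qed (use F F_borel S B T ch in \<open>auto simp: v_def\<close>)
        also have "cell_average \<sigma> c\<^sub>0 S / T = 4 ^ n * (B / T)" by (simp add: B_def)
        also have "\<dots> powr \<epsilon> = 4 powr (n * \<epsilon>) * (B / T) powr \<epsilon>"
          using B T by (subst powr_mult) (simp_all add: powr_powr flip: powr_realpow)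
        finally show "T powr p * (\<Sum>I | I \<in> F \<and> T \<le> v I. measure \<omega> I)
            \<le> M * 4 powr (n * \<epsilon>) * s0 * (B / T) powr \<epsilon>"
          by (simp add: s0_def I0_eq ac_simps)
      qed (use p C M s0_pos ch F(2) in \<open>auto simp: v_def\<close>)
      also have "a powr p * (2 powr p * (M * 4 powr (n * \<epsilon>) * s0) / (1 - 2 powr - \<epsilon>)) = s0 * W"
        by (simp add: W_def)
      finally show ?thesis .
    qed
    have "(\<Sum>\<^sub>\<infinity>I\<in>\<I>. emeasure \<omega> I * ennpowr (P_int I (density \<sigma> (indicator I\<^sub>0))) p) \<le> ennreal (s0 * W)"
      by (intro infsum_le_finite_sums nonneg_summable_on_complete finite_bound) auto
    also have "\<dots> = emeasure \<sigma> I\<^sub>0 * ennreal W"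
      using s0_pos by (simp add: s0 ennreal_mult')
    finally show ?thesis
      using nz by (intro divide_le_posI_ennreal) (auto simp: zero_less_iff_neq_zero)
  qed
  define Y where "Y = (SUP (I\<^sub>0, \<I>) \<in> {(I\<^sub>0, \<I>) \<in> cube_decompositions. emeasure \<sigma> I\<^sub>0 \<noteq> 0}.
        (\<Sum>\<^sub>\<infinity>I\<in>\<I>. emeasure \<omega> I * ennpowr (P_int I (density \<sigma> (indicator I\<^sub>0))) p)
          / emeasure \<sigma> I\<^sub>0)"
  have "Y \<le> ennreal W"
    unfolding Y_def by (intro SUP_least) (use main in auto)
  also have "\<dots> < \<infinity>" by simp
  finally have "ennpowr Y (1 / p) < \<infinity>" by (simp add: ennpowr_def)
  then show ?thesis
    by (simp add: pivotal_condition_def pivotal_const_def Y_def)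
qed

end
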